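(* Let $F=\{f_i\}_{i=1}^N$ be a frame for an $n$-dimensional Hilbert space $\mathcal{H}_n$ with frame operator $S_F$, and let $p>1$. Let $L=\max\{\|S_F^{-1/2}f_i\|:1\le i\le N\}$, $I_1=\{i:\|S_F^{-1/2}f_i\|=L\}$, $I_2=\{1,\dots,N\}\setminus I_1$, and $H_j=\mathrm{span}\{f_i:i\in I_j\}$ for $j=1,2$. Suppose (i) $H_1\cap H_2=\{0\}$ and (ii) $\{f_i:i\in I_2\}$ is linearly independent. Then the canonical dual frame $S_F^{-1}F=\{S_F^{-1}f_i\}_{i=1}^N$ is a $1$-erasure spectrally optimal dual frame of $F$, i.e. $S_F^{-1}F\in\zeta_{\mathfrak{R}}^{(1),p}(F)$.
   Context: $S_F f=\sum_i\langle f,f_i\rangle f_i$ is the (positive invertible) frame operator. $G=\{g_i\}$ is a dual of $F$ if $f=\sum_i\langle f,f_i\rangle g_i$ for all $f$. For a dual $G$, $\mathrm{AE}_{\mathfrak{R}}^{(1),p}(F,G)=\{\frac1N\sum_{i=1}^N|\langle f_i,g_i\rangle|^p\}^{1/p}$ (the $\ell^p$-average of the spectral radii of the one-erasure error operators $f\mapsto\langle f,f_i\rangle g_i$), and $\zeta_{\mathfrak{R}}^{(1),p}(F)$ is the set of duals minimizing it over all duals of $F$. *)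

theory Defs
  imports "HOL-Analysis.Analysis"
begin

text \<open>The n-dimensional Hilbert space H_n is modelled as complex^'n with the
standard inner product (linear in the first argument).\<close>

definition cinner :: "complex ^ 'n \<Rightarrow> complex ^ 'n \<Rightarrow> complex" where
  "cinner x y = (\<Sum>j\<in>UNIV. x $ j * cnj (y $ j))"

definition cnorm :: "complex ^ 'n \<Rightarrow> real" where
  "cnorm x = sqrt (Re (cinner x x))"

text \<open>Frame F = (F 0, ..., F (N-1)) with frame bounds 0 < A <= B.\<close>
definition is_frame :: "(nat \<Rightarrow> complex ^ 'n) \<Rightarrow> nat \<Rightarrow> bool" where
  "is_frame F N \<longleftrightarrow> (\<exists>A B. 0 < A \<and> A \<le> B \<and>
     (\<forall>f. A * (cnorm f)^2 \<le> (\<Sum>i<N. (cmod (cinner f (F i)))^2) \<and>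
          (\<Sum>i<N. (cmod (cinner f (F i)))^2) \<le> B * (cnorm f)^2))"

definition frame_op :: "(nat \<Rightarrow> complex ^ 'n) \<Rightarrow> nat \<Rightarrow> complex ^ 'n \<Rightarrow> complex ^ 'n" where
  "frame_op F N f = (\<Sum>i<N. cinner f (F i) *s F i)"

definition is_dual :: "(nat \<Rightarrow> complex ^ 'n) \<Rightarrow> (nat \<Rightarrow> complex ^ 'n) \<Rightarrow> nat \<Rightarrow> bool" where
  "is_dual F G N \<longleftrightarrow> (\<forall>f. f = (\<Sum>i<N. cinner f (F i) *s G i))"

text \<open>Positive (semidefinite) operator and its positive square root.\<close>
definition positive_op :: "(complex ^ 'n \<Rightarrow> complex ^ 'n) \<Rightarrow> bool" where
  "positive_op R \<longleftrightarrow> Vector_Spaces.linear (*s) (*s) R \<and>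
     (\<forall>x. Im (cinner (R x) x) = 0 \<and> Re (cinner (R x) x) \<ge> 0)"

definition op_sqrt :: "(complex ^ 'n \<Rightarrow> complex ^ 'n) \<Rightarrow> (complex ^ 'n \<Rightarrow> complex ^ 'n)" where
  "op_sqrt T = (THE R. positive_op R \<and> R \<circ> R = T)"

text \<open>Canonical dual frame S_F^{-1} F.\<close>
definition canonical_dual :: "(nat \<Rightarrow> complex ^ 'n) \<Rightarrow> nat \<Rightarrow> nat \<Rightarrow> complex ^ 'n" where
  "canonical_dual F N i = inv (frame_op F N) (F i)"

text \<open>AE^{(1),p}_R(F,G): l^p average of spectral radii of the one-erasure
error operators f \<mapsto> <f,f_i> g_i, which equal |<f_i,g_i>|.\<close>
definition AE1 :: "real \<Rightarrow> (nat \<Rightarrow> complex ^ 'n) \<Rightarrow> (nat \<Rightarrow> complex ^ 'n) \<Rightarrow> nat \<Rightarrow> real" where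
  "AE1 p F G N = ((1 / real N) * (\<Sum>i<N. (cmod (cinner (F i) (G i))) powr p)) powr (1 / p)"

definition zeta1 :: "real \<Rightarrow> (nat \<Rightarrow> complex ^ 'n) \<Rightarrow> nat \<Rightarrow> (nat \<Rightarrow> complex ^ 'n) set" where
  "zeta1 p F N = {G. is_dual F G N \<and> (\<forall>G'. is_dual F G' N \<longrightarrow> AE1 p F G N \<le> AE1 p F G' N)}"

end

theory Submission
  imports Defs
begin

text \<open>Every dual of F has the form g_i = S^{-1} f_i + h_i with \<Sum>_i <x, f_i> h_i = 0 for all x.
  Taking the trace of this operator gives \<Sum>_i <f_i, h_i> = 0, and hypotheses (i) and (ii) force
  h_i = 0 for i \<in> I_2. The diagonal entries a_i = <f_i, S^{-1} f_i> = \<parallel>S^{-1/2} f_i\<parallel>^2 of the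
  canonical dual equal L^2 on I_1, so \<Sum>_i a_i^(p-1) Re <f_i, h_i> = 0, and the tangent-line
  inequality for the convex function t \<mapsto> t^p yields
  \<Sum>_i a_i^p \<le> \<Sum>_i |a_i + <f_i, h_i>|^p = \<Sum>_i |<f_i, g_i>|^p.
  The square root S^{-1/2} is built from an orthonormal eigenbasis, which in turn comes from
  maximising the quadratic form <T x, x> on unit spheres of invariant subspaces.\<close>

section \<open>The inner product on complex vectors\<close>

lemma cinner_add_left: "cinner (x + y) z = cinner x z + cinner y z"
  unfolding cinner_def by (simp add: distrib_right sum.distrib)

lemma cinner_add_right: "cinner z (x + y) = cinner z x + cinner z y"
  unfolding cinner_def by (simp add: distrib_left sum.distrib)

lemma cinner_diff_left: "cinner (x - y) z = cinner x z - cinner y z"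
  unfolding cinner_def by (simp add: left_diff_distrib sum_subtractf)

lemma cinner_scale_left: "cinner (c *s x) z = c * cinner x z"
  unfolding cinner_def by (simp add: sum_distrib_left mult.assoc)

lemma cinner_scale_right: "cinner z (c *s x) = cnj c * cinner z x"
  unfolding cinner_def by (simp add: sum_distrib_left algebra_simps)

lemma cinner_zero_left [simp]: "cinner 0 z = 0"
  unfolding cinner_def by simp

lemma cinner_zero_right [simp]: "cinner z 0 = 0"
  unfolding cinner_def by simp

lemma cinner_commute: "cinner y x = cnj (cinner x y)"
  unfolding cinner_def by (simp add: mult.commute)

lemma cinner_sum_left: "cinner (\<Sum>i\<in>A. f i) z = (\<Sum>i\<in>A. cinner (f i) z)"
  by (induction A rule: infinite_finite_induct) (auto simp: cinner_add_left)

lemma cinner_sum_right: "cinner z (\<Sum>i\<in>A. f i) = (\<Sum>i\<in>A. cinner z (f i))"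
  by (induction A rule: infinite_finite_induct) (auto simp: cinner_add_right)

lemma cinner_self: "cinner x x = complex_of_real ((norm x)\<^sup>2)"
proof -
  have "cinner x x = (\<Sum>j\<in>UNIV. complex_of_real ((cmod (x $ j))\<^sup>2))"
    unfolding cinner_def by (intro sum.cong refl) (metis complex_norm_square)
  also have "\<dots> = complex_of_real (\<Sum>j\<in>UNIV. (cmod (x $ j))\<^sup>2)"
    by simp
  also have "(\<Sum>j\<in>UNIV. (cmod (x $ j))\<^sup>2) = (norm x)\<^sup>2"
    unfolding norm_vec_def L2_set_def by (simp add: sum_nonneg)
  finally show ?thesis .
qed

lemma cinner_self_eq_0 [simp]: "cinner x x = 0 \<longleftrightarrow> x = 0"
  by (simp add: cinner_self)

lemma Re_cinner_self: "Re (cinner x x) = (norm x)\<^sup>2"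
  by (simp add: cinner_self)

lemma cnorm_eq_norm: "cnorm x = norm x"
  unfolding cnorm_def by (simp add: Re_cinner_self)

lemma cinner_mult_cinner_commute:
  "cinner x y * cinner y x = complex_of_real ((cmod (cinner x y))\<^sup>2)"
  by (simp add: cinner_commute[of y x] complex_norm_square[symmetric])

lemma cinner_axis_left: "cinner (axis j 1) v = cnj (v $ j)"
proof -
  have "cinner (axis j 1) v = (\<Sum>k\<in>UNIV. if k = j then cnj (v $ k) else 0)"
    unfolding cinner_def by (intro sum.cong) (auto simp: axis_def)
  then show ?thesis by simp
qed

lemma cinner_axis_right: "cinner v (axis j 1) = v $ j"
proof -
  have "cinner v (axis j 1) = (\<Sum>k\<in>UNIV. if k = j then v $ k else 0)"
    unfolding cinner_def by (intro sum.cong) (auto simp: axis_def)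
  then show ?thesis by simp
qed

lemma scaleR_eq_scale_of_real: "r *\<^sub>R (x :: complex ^ 'n) = complex_of_real r *s x"
  by (vector scaleR_conv_of_real)

lemma subspace_if_vec_subspace: "vec.subspace V \<Longrightarrow> subspace (V :: (complex ^ 'n) set)"
  unfolding vec.subspace_def subspace_def by (simp add: scaleR_eq_scale_of_real)

lemma linear_if_vec_linear:
  fixes T :: "complex ^ 'n \<Rightarrow> complex ^ 'n"
  assumes "Vector_Spaces.linear (*s) (*s) T"
  shows "linear T"
  by (rule linearI)
    (simp_all add: vec.linear_add[OF assms] vec.linear_scale[OF assms] scaleR_eq_scale_of_real)

lemma continuous_on_cinner [continuous_intros]:
  "continuous_on S f \<Longrightarrow> continuous_on S g \<Longrightarrow> continuous_on S (\<lambda>x. cinner (f x) (g x))"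
  unfolding cinner_def by (intro continuous_intros)

section \<open>Hermitian and positive operators\<close>

definition hermitian :: "(complex ^ 'n \<Rightarrow> complex ^ 'n) \<Rightarrow> bool" where
  "hermitian T \<longleftrightarrow> (\<forall>x y. cinner (T x) y = cinner x (T y))"

lemma hermitian_if_real_quadratic_form:
  fixes T :: "complex ^ 'n \<Rightarrow> complex ^ 'n"
  assumes lin: "Vector_Spaces.linear (*s) (*s) T" and real: "\<And>x. Im (cinner (T x) x) = 0"
  shows "hermitian T"
proof -
  define D where "D x y = cinner (T x) y - cinner x (T y)" for x y
  have D_diag: "D x x = 0" for x
    using real[of x] cinner_commute[of x "T x"] unfolding D_def by (simp add: complex_eq_iff)
  have D_add: "D (x + y) (x + y) = D x x + D x y + D y x + D y y" for x y
    unfolding D_def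
    by (simp add: vec.linear_add[OF lin] cinner_add_left cinner_add_right algebra_simps)
  have D_add_i: "D (x + \<i> *s y) (x + \<i> *s y) = D x x - \<i> * D x y + \<i> * D y x + D y y" for x y
    unfolding D_def
    by (simp add: vec.linear_add[OF lin] vec.linear_scale[OF lin] cinner_add_left cinner_add_right
        cinner_scale_left cinner_scale_right algebra_simps)
  have "D x y = 0" for x y
    using D_add[of x y] D_add_i[of x y] D_diag by (simp add: algebra_simps)
  then show ?thesis unfolding hermitian_def D_def by simp
qed

lemma positive_opD:
  assumes "positive_op R"
  shows "Vector_Spaces.linear (*s) (*s) R"
    and "cinner (R x) x = complex_of_real (Re (cinner (R x) x))"
    and "Re (cinner (R x) x) \<ge> 0"
  using assms unfolding positive_op_def by (simp_all add: complex_eq_iff)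

lemma positive_op_hermitian: "positive_op R \<Longrightarrow> hermitian R"
  using hermitian_if_real_quadratic_form unfolding positive_op_def by blast

section \<open>Spectral theorem for hermitian operators\<close>

lemma quadratic_form_scale:
  assumes "Vector_Spaces.linear (*s) (*s) T"
  shows "Re (cinner (T (complex_of_real r *s y)) (complex_of_real r *s y)) =
    r\<^sup>2 * Re (cinner (T y) y)"
  by (simp add: vec.linear_scale[OF assms] cinner_scale_left cinner_scale_right power2_eq_square)

lemma quadratic_form_add_scale:
  assumes "Vector_Spaces.linear (*s) (*s) T" "hermitian T"
  shows "Re (cinner (T (x + complex_of_real t *s y)) (x + complex_of_real t *s y)) =
     Re (cinner (T x) x) + 2 * t * Re (cinner (T x) y) + t\<^sup>2 * Re (cinner (T y) y)"
proof -
  have "cinner (T y) x = cnj (cinner (T x) y)"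
    using assms(2) unfolding hermitian_def by (metis cinner_commute)
  then show ?thesis
    by (simp add: vec.linear_add[OF assms(1)] vec.linear_scale[OF assms(1)] cinner_add_left
        cinner_add_right cinner_scale_left cinner_scale_right power2_eq_square algebra_simps)
qed

lemma quadratic_form_attains_max:
  fixes T :: "complex ^ 'n \<Rightarrow> complex ^ 'n"
  assumes lin: "Vector_Spaces.linear (*s) (*s) T" and V: "vec.subspace V" and "V \<noteq> {0}"
  obtains x0 where "x0 \<in> V" "norm x0 = 1"
    "\<And>z. z \<in> V \<Longrightarrow> Re (cinner (T z) z) \<le> Re (cinner (T x0) x0) * (norm z)\<^sup>2"
proof -
  define q where "q x = Re (cinner (T x) x)" for x
  define K where "K = V \<inter> sphere 0 1"
  have V_real: "subspace V" using subspace_if_vec_subspace[OF V] .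
  have "compact K"
    unfolding K_def by (intro closed_Int_compact closed_subspace V_real compact_sphere)
  obtain v where "v \<in> V" "v \<noteq> 0" using \<open>V \<noteq> {0}\<close> vec.subspace_0[OF V] by blast
  then have "(1 / norm v) *\<^sub>R v \<in> K" unfolding K_def using V_real by (simp add: subspace_scale)
  then have "K \<noteq> {}" by blast
  have "continuous_on K q"
    unfolding q_def
    using linear_continuous_on linear_conv_bounded_linear linear_if_vec_linear[OF lin]
    by (intro continuous_intros) auto
  then obtain x0 where x0: "x0 \<in> K" "\<And>y. y \<in> K \<Longrightarrow> q y \<le> q x0"
    using continuous_attains_sup[OF \<open>compact K\<close> \<open>K \<noteq> {}\<close>] by blast
  have "q z \<le> q x0 * (norm z)\<^sup>2" if "z \<in> V" for z
  proof (cases "z = 0")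
    case True
    then show ?thesis by (simp add: q_def vec.linear_0[OF lin])
  next
    case False
    define r where "r = 1 / norm z"
    have "r *\<^sub>R z \<in> K" unfolding K_def r_def using that V_real False by (simp add: subspace_scale)
    then have "q (r *\<^sub>R z) \<le> q x0" using x0(2) by blast
    then have "r\<^sup>2 * q z \<le> q x0"
      unfolding q_def scaleR_eq_scale_of_real quadratic_form_scale[OF lin] .
    then have "r\<^sup>2 * q z * (norm z)\<^sup>2 \<le> q x0 * (norm z)\<^sup>2"
      by (simp add: mult_right_mono)
    moreover have "r\<^sup>2 * (norm z)\<^sup>2 = 1" unfolding r_def using False by (simp add: power2_eq_square)
    ultimately show ?thesis by (simp add: algebra_simps)
  qed
  with x0(1) show ?thesis using that unfolding K_def q_def by auto
qed

lemma nonpos_if_quadratic_bound: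
  fixes s C :: real
  assumes "\<And>t. 2 * t * s \<le> t\<^sup>2 * C"
  shows "s \<le> 0"
proof (rule ccontr)
  assume "\<not> s \<le> 0"
  define t where "t = s / (\<bar>C\<bar> + 1)"
  have "t > 0" unfolding t_def using \<open>\<not> s \<le> 0\<close> by simp
  have "2 * s \<le> t * C" using assms[of t] \<open>t > 0\<close> by (simp add: power2_eq_square mult.assoc)
  also have "\<dots> \<le> t * \<bar>C\<bar>" using \<open>t > 0\<close> by (simp add: mult_left_mono)
  also have "\<dots> < s" unfolding t_def using \<open>\<not> s \<le> 0\<close> by (simp add: field_simps)
  finally show False using \<open>\<not> s \<le> 0\<close> by simp
qed

lemma max_quadratic_form_eigenvector:
  fixes T :: "complex ^ 'n \<Rightarrow> complex ^ 'n"
  assumes lin: "Vector_Spaces.linear (*s) (*s) T" and herm: "hermitian T"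
    and V: "vec.subspace V" and invariant: "\<And>x. x \<in> V \<Longrightarrow> T x \<in> V"
    and x0: "x0 \<in> V" "cinner x0 x0 = 1"
    and max: "\<And>z. z \<in> V \<Longrightarrow> Re (cinner (T z) z) \<le> Re (cinner (T x0) x0) * (norm z)\<^sup>2"
  shows "T x0 = cinner (T x0) x0 *s x0"
proof -
  define w where "w = T x0 - cinner (T x0) x0 *s x0"
  have "w \<in> V"
    unfolding w_def using invariant x0(1) V by (simp add: vec.subspace_diff vec.subspace_scale)
  have w_x0: "cinner w x0 = 0"
    unfolding w_def by (simp add: cinner_diff_left cinner_scale_left x0(2))
  have x0_w: "cinner x0 w = 0" using w_x0 cinner_commute[of x0 w] by simp
  have "cinner (T x0) w = cinner w w + cinner (T x0) x0 * cinner x0 w"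
    unfolding w_def by (simp add: cinner_diff_left cinner_scale_left algebra_simps)
  then have Tx0_w: "Re (cinner (T x0) w) = (norm w)\<^sup>2" using x0_w by (simp add: Re_cinner_self)
  \<comment> \<open>along the line x0 + t w the bound has linear term 2 t \<parallel>w\<parallel>^2, which forces w = 0\<close>
  have "2 * t * (norm w)\<^sup>2 \<le> t\<^sup>2 * (Re (cinner (T x0) x0) * (norm w)\<^sup>2 - Re (cinner (T w) w))" for t
  proof -
    let ?z = "x0 + complex_of_real t *s w"
    have "?z \<in> V" using x0(1) \<open>w \<in> V\<close> V by (simp add: vec.subspace_add vec.subspace_scale)
    have "cinner ?z ?z = 1 + complex_of_real (t\<^sup>2) * cinner w w"
      by (simp add: cinner_add_left cinner_add_right cinner_scale_left cinner_scale_right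
          x0 w_x0 x0_w power2_eq_square)
    then have "(norm ?z)\<^sup>2 = 1 + t\<^sup>2 * (norm w)\<^sup>2"
      by (metis Re_cinner_self Re_complex_of_real cinner_self of_real_add of_real_mult
          of_real_1)
    then show ?thesis
      using max[OF \<open>?z \<in> V\<close>] unfolding quadratic_form_add_scale[OF lin herm] Tx0_w
      by (simp add: algebra_simps)
  qed
  then have "(norm w)\<^sup>2 \<le> 0" by (rule nonpos_if_quadratic_bound)
  then show ?thesis unfolding w_def by simp
qed

lemma hermitian_eigenvector_exists:
  fixes T :: "complex ^ 'n \<Rightarrow> complex ^ 'n"
  assumes "Vector_Spaces.linear (*s) (*s) T" "hermitian T" "vec.subspace V"
    "\<And>x. x \<in> V \<Longrightarrow> T x \<in> V" "V \<noteq> {0}"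
  obtains e l where "e \<in> V" "cinner e e = 1" "T e = l *s e"
proof -
  obtain x0 where x0: "x0 \<in> V" "norm x0 = 1"
    "\<And>z. z \<in> V \<Longrightarrow> Re (cinner (T z) z) \<le> Re (cinner (T x0) x0) * (norm z)\<^sup>2"
    using quadratic_form_attains_max[OF assms(1,3,5)] by blast
  then have "cinner x0 x0 = 1" by (simp add: cinner_self)
  with x0 show ?thesis using that max_quadratic_form_eigenvector[OF assms(1-4)] by blast
qed

definition orthonormal :: "(complex ^ 'n) set \<Rightarrow> bool" where
  "orthonormal B \<longleftrightarrow> (\<forall>e\<in>B. \<forall>f\<in>B. cinner e f = (if e = f then 1 else 0))"

definition orthonormal_eigenbasis ::
    "(complex ^ 'n \<Rightarrow> complex ^ 'n) \<Rightarrow> (complex ^ 'n) set \<Rightarrow> (complex ^ 'n) set \<Rightarrow> bool" where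
  "orthonormal_eigenbasis T V B \<longleftrightarrow> finite B \<and> B \<subseteq> V \<and> orthonormal B \<and>
     (\<forall>e\<in>B. \<exists>l. T e = l *s e) \<and> (\<forall>x\<in>V. x = (\<Sum>e\<in>B. cinner x e *s e))"

lemma orthonormal_eigenbasis_insert:
  assumes B: "orthonormal_eigenbasis T {x \<in> V. cinner x e = 0} B" and V: "vec.subspace V"
    and e: "e \<in> V" "cinner e e = 1" "T e = l *s e"
  shows "orthonormal_eigenbasis T V (insert e B)"
proof -
  have B_perp: "cinner b e = 0" "cinner e b = 0" if "b \<in> B" for b
    using B that cinner_commute[of e b] unfolding orthonormal_eigenbasis_def by auto
  have "e \<notin> B" using B_perp e(2) by force
  have "x = (\<Sum>b\<in>insert e B. cinner x b *s b)" if "x \<in> V" for x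
  proof -
    define x' where "x' = x - cinner x e *s e"
    have "x' \<in> V" "cinner x' e = 0"
      unfolding x'_def using that e V by (simp_all add: vec.subspace_diff vec.subspace_scale
          cinner_diff_left cinner_scale_left)
    then have "x' = (\<Sum>b\<in>B. cinner x' b *s b)" using B unfolding orthonormal_eigenbasis_def by auto
    also have "\<dots> = (\<Sum>b\<in>B. cinner x b *s b)"
      by (intro sum.cong refl) (simp add: x'_def cinner_diff_left cinner_scale_left B_perp)
    finally show ?thesis
      using B \<open>e \<notin> B\<close> unfolding x'_def orthonormal_eigenbasis_def by (simp add: algebra_simps)
  qed
  then show ?thesis
    using B e B_perp unfolding orthonormal_eigenbasis_def orthonormal_def by auto
qed

lemma hermitian_orthonormal_eigenbasis_subspace:
  fixes T :: "complex ^ 'n \<Rightarrow> complex ^ 'n"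
  assumes lin: "Vector_Spaces.linear (*s) (*s) T" and herm: "hermitian T"
  shows "vec.subspace V \<Longrightarrow> (\<And>x. x \<in> V \<Longrightarrow> T x \<in> V) \<Longrightarrow> \<exists>B. orthonormal_eigenbasis T V B"
proof (induction "vec.dim V" arbitrary: V rule: less_induct)
  case less
  show ?case
  proof (cases "V = {0}")
    case True
    then show ?thesis
      unfolding orthonormal_eigenbasis_def orthonormal_def by (intro exI[of _ "{}"]) auto
  next
    case False
    then obtain e l where e: "e \<in> V" "cinner e e = 1" "T e = l *s e"
      using hermitian_eigenvector_exists[OF lin herm less.prems] by blast
    define W where "W = {x \<in> V. cinner x e = 0}"
    have "vec.subspace W"
      using less.prems(1) unfolding W_def vec.subspace_def
      by (auto simp: cinner_add_left cinner_scale_left)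
    moreover have "T x \<in> W" if "x \<in> W" for x
    proof -
      have "cinner (T x) e = cinner x (T e)" using herm unfolding hermitian_def by blast
      with that less.prems(2) show ?thesis unfolding W_def e(3) by (simp add: cinner_scale_right)
    qed
    moreover have "vec.dim W < vec.dim V"
    proof -
      have "e \<notin> W" using e(2) unfolding W_def by simp
      then have "W \<subset> V" using e(1) unfolding W_def by blast
      then show ?thesis
        using vec.dim_psubset \<open>vec.subspace W\<close> less.prems(1) by (metis vec.span_eq_iff)
    qed
    ultimately obtain B where "orthonormal_eigenbasis T W B" using less.hyps by blast
    then show ?thesis
      using orthonormal_eigenbasis_insert less.prems(1) e unfolding W_def by blast
  qed
qed

lemma hermitian_orthonormal_eigenbasis:
  fixes T :: "complex ^ 'n \<Rightarrow> complex ^ 'n"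
  assumes "Vector_Spaces.linear (*s) (*s) T" "hermitian T"
  obtains B where "orthonormal_eigenbasis T UNIV B"
  using hermitian_orthonormal_eigenbasis_subspace[OF assms, of UNIV] by auto

section \<open>Positive square roots\<close>

definition diag_op ::
    "(complex ^ 'n) set \<Rightarrow> (complex ^ 'n \<Rightarrow> real) \<Rightarrow> complex ^ 'n \<Rightarrow> complex ^ 'n" where
  "diag_op B \<mu> x = (\<Sum>e\<in>B. (complex_of_real (\<mu> e) * cinner x e) *s e)"

lemma linear_diag_op: "Vector_Spaces.linear (*s) (*s) (diag_op B \<mu>)"
  unfolding Vector_Spaces.linear_iff
proof (intro conjI allI vec.vector_space_axioms)
  fix x y c
  have "diag_op B \<mu> (x + y) =
      (\<Sum>e\<in>B. (complex_of_real (\<mu> e) * cinner x e) *s e + (complex_of_real (\<mu> e) * cinner y e) *s e)"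
    unfolding diag_op_def
    by (intro sum.cong refl) (simp add: cinner_add_left distrib_left vec.scale_left_distrib)
  then show "diag_op B \<mu> (x + y) = diag_op B \<mu> x + diag_op B \<mu> y"
    unfolding diag_op_def by (simp add: sum.distrib)
  have "diag_op B \<mu> (c *s x) = (\<Sum>e\<in>B. c *s ((complex_of_real (\<mu> e) * cinner x e) *s e))"
    unfolding diag_op_def by (intro sum.cong refl) (simp add: cinner_scale_left mult.left_commute)
  then show "diag_op B \<mu> (c *s x) = c *s diag_op B \<mu> x"
    unfolding diag_op_def by (simp add: vec.scale_sum_right)
qed

lemma sum_cinner_orthonormal:
  assumes "finite B" "orthonormal B" "f \<in> B"
  shows "(\<Sum>e\<in>B. c e * cinner e f) = c f"
proof -
  have "(\<Sum>e\<in>B. c e * cinner e f) = (\<Sum>e\<in>B. if e = f then c e else 0)"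
    using assms(2,3) unfolding orthonormal_def by (intro sum.cong) auto
  then show ?thesis using assms(1,3) by simp
qed

lemma cinner_diag_op_basis:
  assumes "finite B" "orthonormal B" "f \<in> B"
  shows "cinner (diag_op B \<mu> x) f = complex_of_real (\<mu> f) * cinner x f"
  unfolding diag_op_def cinner_sum_left cinner_scale_left using sum_cinner_orthonormal[OF assms] .

lemma diag_op_diag_op:
  assumes "finite B" "orthonormal B"
  shows "diag_op B \<mu> (diag_op B \<nu> x) = diag_op B (\<lambda>e. \<mu> e * \<nu> e) x"
  unfolding diag_op_def[of B \<mu>] diag_op_def[of B "\<lambda>e. \<mu> e * \<nu> e"]
  by (intro sum.cong refl) (simp add: cinner_diag_op_basis[OF assms] mult.assoc)

lemma positive_diag_op:
  assumes "\<And>e. \<mu> e \<ge> 0"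
  shows "positive_op (diag_op B \<mu>)"
proof -
  have "cinner (diag_op B \<mu> x) x = complex_of_real (\<Sum>e\<in>B. \<mu> e * (cmod (cinner x e))\<^sup>2)" for x
    unfolding diag_op_def cinner_sum_left cinner_scale_left
    by (simp add: mult.assoc cinner_mult_cinner_commute)
  moreover have "(\<Sum>e\<in>B. \<mu> e * (cmod (cinner x e))\<^sup>2) \<ge> 0" for x
    using assms by (intro sum_nonneg) simp
  ultimately show ?thesis unfolding positive_op_def using linear_diag_op by simp
qed

lemma eq_diag_op_if_eigenvectors:
  assumes lin: "Vector_Spaces.linear (*s) (*s) R" and expand: "\<And>x. x = (\<Sum>e\<in>B. cinner x e *s e)"
    and eigen: "\<And>e. e \<in> B \<Longrightarrow> R e = complex_of_real (\<mu> e) *s e"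
  shows "R = diag_op B \<mu>"
proof
  fix x
  have "R x = R (\<Sum>e\<in>B. cinner x e *s e)"
    using expand by simp
  also have "\<dots> = (\<Sum>e\<in>B. cinner x e *s R e)"
    by (simp add: vec.linear_sum[OF lin] vec.linear_scale[OF lin])
  also have "\<dots> = diag_op B \<mu> x"
    unfolding diag_op_def by (intro sum.cong refl) (simp add: eigen mult.commute)
  finally show "R x = diag_op B \<mu> x" .
qed

lemma positive_op_eigenvector:
  assumes T: "positive_op T" and B: "orthonormal_eigenbasis T UNIV B" and "e \<in> B"
  shows "T e = complex_of_real (Re (cinner (T e) e)) *s e"
proof -
  obtain l where "T e = l *s e" using B \<open>e \<in> B\<close> unfolding orthonormal_eigenbasis_def by blast
  moreover have "cinner e e = 1"
    using B \<open>e \<in> B\<close> unfolding orthonormal_eigenbasis_def orthonormal_def by simp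
  ultimately show ?thesis using positive_opD(2)[OF T, of e] by (simp add: cinner_scale_left)
qed

lemma positive_op_eigenvector_of_square:
  fixes R :: "complex ^ 'n \<Rightarrow> complex ^ 'n"
  assumes R: "positive_op R" and "\<mu> \<ge> 0" and RR: "R (R e) = complex_of_real (\<mu>\<^sup>2) *s e"
  shows "R e = complex_of_real \<mu> *s e"
proof (cases "\<mu> = 0")
  case True
  have "cinner (R e) (R e) = cinner (R (R e)) e"
    using positive_op_hermitian[OF R] unfolding hermitian_def by metis
  with RR True show ?thesis by simp
next
  case False
  have lin: "Vector_Spaces.linear (*s) (*s) R" using positive_opD(1)[OF R] .
  define y where "y = R e - complex_of_real \<mu> *s e"
  \<comment> \<open>R y = - \<mu> y, which is impossible for positive R unless y = 0\<close>
  have "R y + complex_of_real \<mu> *s y = 0"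
    unfolding y_def using RR
    by (simp add: vec.linear_diff[OF lin] vec.linear_scale[OF lin] algebra_simps power2_eq_square)
  then have "Re (cinner (R y + complex_of_real \<mu> *s y) y) = 0" by simp
  then have "Re (cinner (R y) y) + \<mu> * (norm y)\<^sup>2 = 0"
    by (simp add: cinner_add_left cinner_scale_left cinner_self)
  moreover have "Re (cinner (R y) y) \<ge> 0" using positive_opD(3)[OF R] .
  moreover have "\<mu> * (norm y)\<^sup>2 \<ge> 0" using \<open>\<mu> \<ge> 0\<close> by simp
  ultimately have "\<mu> * (norm y)\<^sup>2 = 0" by linarith
  then have "y = 0" using False by simp
  then show ?thesis unfolding y_def by simp
qed

lemma positive_sqrt_exists_unique:
  fixes T :: "complex ^ 'n \<Rightarrow> complex ^ 'n"
  assumes T: "positive_op T"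
  shows "\<exists>!R. positive_op R \<and> R \<circ> R = T"
proof -
  obtain B where B: "orthonormal_eigenbasis T UNIV B"
    using hermitian_orthonormal_eigenbasis[OF positive_opD(1)[OF T] positive_op_hermitian[OF T]] .
  then have "finite B" "orthonormal B" and expand: "\<And>x. x = (\<Sum>e\<in>B. cinner x e *s e)"
    unfolding orthonormal_eigenbasis_def by auto
  define eig where "eig e = Re (cinner (T e) e)" for e
  define \<sigma> where "\<sigma> e = sqrt (eig e)" for e
  have "eig e \<ge> 0" for e unfolding eig_def using positive_opD(3)[OF T] .
  then have \<sigma>: "\<sigma> e \<ge> 0" "\<sigma> e * \<sigma> e = eig e" for e unfolding \<sigma>_def by simp_all
  have T_diag: "T = diag_op B eig"
  proof (rule eq_diag_op_if_eigenvectors[OF positive_opD(1)[OF T] expand])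
    show "T e = complex_of_real (eig e) *s e" if "e \<in> B" for e
      unfolding eig_def by (rule positive_op_eigenvector[OF T B that])
  qed
  have "positive_op (diag_op B \<sigma>)" by (rule positive_diag_op) (rule \<sigma>(1))
  moreover have "diag_op B \<sigma> \<circ> diag_op B \<sigma> = T"
    unfolding T_diag comp_def diag_op_diag_op[OF \<open>finite B\<close> \<open>orthonormal B\<close>] \<sigma>(2) by (rule refl)
  moreover have "R = diag_op B \<sigma>" if R: "positive_op R" "R \<circ> R = T" for R
  proof (rule eq_diag_op_if_eigenvectors[OF positive_opD(1)[OF R(1)] expand])
    fix e assume "e \<in> B"
    have "R (R e) = T e" using R(2) by (metis comp_apply)
    also have "\<dots> = complex_of_real (eig e) *s e"
      unfolding eig_def by (rule positive_op_eigenvector[OF T B \<open>e \<in> B\<close>])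
    also have "eig e = (\<sigma> e)\<^sup>2" using \<sigma>(2)[of e] by (simp add: power2_eq_square)
    finally show "R e = complex_of_real (\<sigma> e) *s e"
      by (rule positive_op_eigenvector_of_square[OF R(1) \<sigma>(1)])
  qed
  ultimately show ?thesis by blast
qed

lemma op_sqrt_spec:
  assumes "positive_op T"
  shows "positive_op (op_sqrt T)" and "op_sqrt T \<circ> op_sqrt T = T"
  using theI'[OF positive_sqrt_exists_unique[OF assms]] unfolding op_sqrt_def by auto

lemma cinner_op_sqrt:
  assumes T: "positive_op T"
  shows "cinner x (T x) = complex_of_real ((cnorm (op_sqrt T x))\<^sup>2)"
proof -
  have "cinner (op_sqrt T x) (op_sqrt T x) = cinner (op_sqrt T (op_sqrt T x)) x"
    using positive_op_hermitian[OF op_sqrt_spec(1)[OF T]] unfolding hermitian_def by metis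
  also have "\<dots> = cinner (T x) x" using op_sqrt_spec(2)[OF T] by (metis comp_apply)
  finally have "Re (cinner (op_sqrt T x) (op_sqrt T x)) = Re (cinner (T x) x)" by simp
  then have "(cnorm (op_sqrt T x))\<^sup>2 = Re (cinner (T x) x)"
    unfolding cnorm_eq_norm Re_cinner_self .
  moreover have "cinner x (T x) = cinner (T x) x"
    using positive_opD(2)[OF T, of x] cinner_commute[of x "T x"]
    by (metis complex_cnj_complex_of_real)
  ultimately show ?thesis using positive_opD(2)[OF T, of x] by simp
qed

section \<open>The frame operator and the canonical dual\<close>

lemma linear_frame_op: "Vector_Spaces.linear (*s) (*s) (frame_op F N)"
  unfolding Vector_Spaces.linear_iff frame_op_def
  by (simp add: vec.vector_space_axioms cinner_add_left cinner_scale_left sum.distrib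
      vec.scale_left_distrib vec.scale_sum_right)

lemma cinner_frame_op_self:
  "cinner (frame_op F N x) x = complex_of_real (\<Sum>i<N. (cmod (cinner x (F i)))\<^sup>2)"
  unfolding frame_op_def cinner_sum_left cinner_scale_left by (simp add: cinner_mult_cinner_commute)

lemma positive_frame_op: "positive_op (frame_op F N)"
  unfolding positive_op_def cinner_frame_op_self using linear_frame_op by (simp add: sum_nonneg)

lemma inj_frame_op:
  assumes "is_frame F N"
  shows "inj (frame_op F N)"
proof -
  obtain A where "A > 0" and lower: "\<And>f. A * (cnorm f)\<^sup>2 \<le> (\<Sum>i<N. (cmod (cinner f (F i)))\<^sup>2)"
    using assms unfolding is_frame_def by blast
  have "x = 0" if "frame_op F N x = 0" for x
  proof -
    have "complex_of_real (\<Sum>i<N. (cmod (cinner x (F i)))\<^sup>2) = 0"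
      using that cinner_frame_op_self[of F N x] by (metis cinner_zero_left)
    then have "(\<Sum>i<N. (cmod (cinner x (F i)))\<^sup>2) = 0" by (rule of_real_eq_0_iff[THEN iffD1])
    then have "A * (norm x)\<^sup>2 \<le> 0" using lower[of x] by (simp add: cnorm_eq_norm)
    with \<open>A > 0\<close> show ?thesis by (simp add: mult_le_0_iff)
  qed
  then show ?thesis using vec.linear_inj_iff_eq_0[OF linear_frame_op] by blast
qed

lemma positive_op_inv:
  assumes T: "positive_op T" and "inj T"
  shows "positive_op (inv T)"
proof -
  have lin: "Vector_Spaces.linear (*s) (*s) T" using positive_opD(1)[OF T] .
  have "surj T" using vec.linear_inj_imp_surj[OF lin \<open>inj T\<close>] .
  have "cinner (inv T x) x = cinner (T (inv T x)) (inv T x)" for x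
  proof -
    have "cinner (inv T x) x = cinner (inv T x) (T (inv T x))"
      using \<open>surj T\<close> by (simp add: surj_f_inv_f)
    also have "\<dots> = cinner (T (inv T x)) (inv T x)"
      using positive_op_hermitian[OF T] unfolding hermitian_def by metis
    finally show ?thesis .
  qed
  then show ?thesis
    using vec.inj_linear_imp_inv_linear[OF lin \<open>inj T\<close>] T unfolding positive_op_def by simp
qed

lemma positive_inv_frame_op: "is_frame F N \<Longrightarrow> positive_op (inv (frame_op F N))"
  using positive_op_inv[OF positive_frame_op inj_frame_op] .

lemma canonical_dual_is_dual:
  assumes "is_frame F N"
  shows "is_dual F (canonical_dual F N) N"
  unfolding is_dual_def
proof
  fix f
  have lin: "Vector_Spaces.linear (*s) (*s) (inv (frame_op F N))"
    using positive_opD(1)[OF positive_inv_frame_op[OF assms]] .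
  have "(\<Sum>i<N. cinner f (F i) *s canonical_dual F N i) = inv (frame_op F N) (frame_op F N f)"
    unfolding canonical_dual_def
    by (simp add: frame_op_def[of F N f] vec.linear_sum[OF lin] vec.linear_scale[OF lin])
  also have "\<dots> = f" using inj_frame_op[OF assms] by (simp add: inv_f_f)
  finally show "f = (\<Sum>i<N. cinner f (F i) *s canonical_dual F N i)" ..
qed

lemma cinner_canonical_dual:
  assumes "is_frame F N"
  shows "cinner (F i) (canonical_dual F N i) =
    complex_of_real ((cnorm (op_sqrt (inv (frame_op F N)) (F i)))\<^sup>2)"
  unfolding canonical_dual_def using cinner_op_sqrt[OF positive_inv_frame_op[OF assms]] .

lemma dual_diff_annihilated:
  assumes "is_dual F G N" "is_dual F G' N"
  shows "(\<Sum>i<N. cinner x (F i) *s (G i - G' i)) = 0"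
  using assms unfolding is_dual_def by (simp add: vec.scale_right_diff_distrib sum_subtractf)

section \<open>Perturbations of the canonical dual\<close>

lemma independent_image_coeff_eq_0:
  fixes F :: "nat \<Rightarrow> complex ^ 'n"
  assumes inj: "inj_on F I" and indep: "vec.independent (F ` I)" and "finite I"
    and comb: "(\<Sum>i\<in>I. c i *s F i) = 0" and "i \<in> I"
  shows "c i = 0"
proof -
  define u where "u v = c (the_inv_into I F v)" for v
  have "(\<Sum>v\<in>F ` I. u v *s v) = (\<Sum>i\<in>I. c i *s F i)"
    unfolding sum.reindex[OF inj] u_def
    by (intro sum.cong refl) (simp add: the_inv_into_f_f[OF inj])
  then have "\<forall>v\<in>F ` I. u v = 0"
    using comb indep vec.dependent_finite[of "F ` I"] \<open>finite I\<close> by auto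
  then show ?thesis unfolding u_def using the_inv_into_f_f[OF inj \<open>i \<in> I\<close>] \<open>i \<in> I\<close> by force
qed

lemma annihilated_adjoint:
  fixes F :: "nat \<Rightarrow> complex ^ 'n"
  assumes ann: "\<And>x. (\<Sum>i<N. cinner x (F i) *s h i) = 0"
  shows "(\<Sum>i<N. cinner y (h i) *s F i) = 0"
proof -
  let ?v = "\<Sum>i<N. cinner y (h i) *s F i"
  have "cinner x ?v = cinner (\<Sum>i<N. cinner x (F i) *s h i) y" for x
    unfolding cinner_sum_left cinner_sum_right cinner_scale_left cinner_scale_right
    by (intro sum.cong refl) (simp add: cinner_commute[of y] mult.commute)
  then have "cinner ?v ?v = 0" using ann by simp
  then show ?thesis by simp
qed

lemma annihilated_vanishes_on_independent_part:
  fixes F :: "nat \<Rightarrow> complex ^ 'n"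
  assumes ann: "\<And>x. (\<Sum>i<N. cinner x (F i) *s h i) = 0"
    and partition: "I \<union> J = {..<N}" "I \<inter> J = {}"
    and disj: "vec.span (F ` I) \<inter> vec.span (F ` J) = {0}"
    and inj: "inj_on F J" and indep: "vec.independent (F ` J)"
    and "j \<in> J"
  shows "h j = 0"
proof -
  have "cinner y (h j) = 0" for y
  proof -
    have "finite (I \<union> J)" unfolding partition(1) by simp
    then have fin: "finite I" "finite J" by simp_all
    let ?vI = "\<Sum>i\<in>I. cinner y (h i) *s F i" and ?vJ = "\<Sum>i\<in>J. cinner y (h i) *s F i"
    have "?vI + ?vJ = (\<Sum>i\<in>I \<union> J. cinner y (h i) *s F i)"
      by (rule sum.union_disjoint[OF fin partition(2), symmetric])
    also have "\<dots> = 0" unfolding partition(1) by (rule annihilated_adjoint[OF ann])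
    finally have "?vJ = - ?vI" by (simp add: add_eq_0_iff2)
    have "?vI \<in> vec.span (F ` I)"
      by (intro vec.span_sum vec.span_scale vec.span_base) auto
    then have "?vJ \<in> vec.span (F ` I)" unfolding \<open>?vJ = - ?vI\<close> by (rule vec.span_neg)
    moreover have "?vJ \<in> vec.span (F ` J)"
      by (intro vec.span_sum vec.span_scale vec.span_base) auto
    ultimately have "?vJ = 0" using disj by (metis IntI singletonD)
    then show ?thesis
      by (rule independent_image_coeff_eq_0[OF inj indep fin(2), where c = "\<lambda>i. cinner y (h i)"])
        (rule \<open>j \<in> J\<close>)
  qed
  then have "cinner (h j) (h j) = 0" .
  then show ?thesis by simp
qed

lemma annihilated_trace_eq_0:
  fixes F :: "nat \<Rightarrow> complex ^ 'n"
  assumes ann: "\<And>x. (\<Sum>i<N. cinner x (F i) *s h i) = 0"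
  shows "(\<Sum>i<N. cinner (F i) (h i)) = 0"
proof -
  \<comment> \<open>pairing the identity for x = axis j 1 with axis j 1 gives the j-th term of the trace\<close>
  have "(\<Sum>i<N. F i $ j * cnj (h i $ j)) = 0" for j
  proof -
    have "0 = cinner (\<Sum>i<N. cinner (axis j 1) (F i) *s h i) (axis j 1)"
      unfolding ann by simp
    also have "\<dots> = (\<Sum>i<N. cinner (axis j 1) (F i) * cinner (h i) (axis j 1))"
      unfolding cinner_sum_left cinner_scale_left ..
    also have "\<dots> = (\<Sum>i<N. cnj (F i $ j) * h i $ j)"
      unfolding cinner_axis_left cinner_axis_right ..
    finally have "cnj (\<Sum>i<N. cnj (F i $ j) * h i $ j) = 0" by simp
    then show ?thesis by simp
  qed
  then have "(\<Sum>j\<in>UNIV. \<Sum>i<N. F i $ j * cnj (h i $ j)) = 0" by simp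
  then show ?thesis unfolding cinner_def by (subst sum.swap)
qed

lemma powr_tangent_le:
  fixes a p :: real and c :: complex
  assumes "a \<ge> 0" "p > 1"
  shows "a powr p + p * a powr (p - 1) * (Re c - a) \<le> (cmod c) powr p"
proof (cases "a = 0")
  case True
  then show ?thesis using \<open>p > 1\<close> by simp
next
  case False
  then have "a > 0" using \<open>a \<ge> 0\<close> by simp
  show ?thesis
  proof (cases "Re c \<le> 0")
    case True
    have "p * a powr (p - 1) * (Re c - a) \<le> p * a powr (p - 1) * (- a)"
      using True \<open>p > 1\<close> by (intro mult_left_mono) auto
    also have "\<dots> = - p * a powr p" using \<open>a > 0\<close> by (simp add: powr_diff)
    finally have "a powr p + p * a powr (p - 1) * (Re c - a) \<le> (1 - p) * a powr p"
      by (simp add: algebra_simps)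
    also have "\<dots> \<le> 0" using \<open>p > 1\<close> by (simp add: mult_nonpos_nonneg)
    also have "0 \<le> (cmod c) powr p" by simp
    finally show ?thesis .
  next
    case False
    have convex: "convex_on {0<..} (\<lambda>x. x powr p)" using powr_convex \<open>p > 1\<close> by simp
    have "((\<lambda>x. x powr p) has_real_derivative p * a powr (p - 1)) (at a within {0<..})"
      using has_real_derivative_powr[OF \<open>a > 0\<close>] by (rule has_field_derivative_at_within)
    then have "p * a powr (p - 1) * (Re c - a) \<le> (Re c) powr p - a powr p"
      using convex_on_imp_above_tangent[OF convex, of a "Re c"] \<open>a > 0\<close> False
      by (simp add: interior_open)
    moreover have "(Re c) powr p \<le> (cmod c) powr p"
      using False \<open>p > 1\<close> by (intro powr_mono2) (auto simp: complex_Re_le_cmod)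
    ultimately show ?thesis by simp
  qed
qed

lemma sum_powr_le_if_tangent_sum_eq_0:
  fixes a :: "nat \<Rightarrow> real" and d :: "nat \<Rightarrow> complex"
  assumes "\<And>i. i \<in> I \<Longrightarrow> a i \<ge> 0" "p > 1"
    and tangent: "(\<Sum>i\<in>I. a i powr (p - 1) * Re (d i)) = 0"
  shows "(\<Sum>i\<in>I. a i powr p) \<le> (\<Sum>i\<in>I. (cmod (complex_of_real (a i) + d i)) powr p)"
proof -
  have "(\<Sum>i\<in>I. a i powr p) = (\<Sum>i\<in>I. a i powr p + p * a i powr (p - 1) * Re (d i))"
    using tangent by (simp add: sum.distrib mult.assoc flip: sum_distrib_left)
  also have "\<dots> \<le> (\<Sum>i\<in>I. (cmod (complex_of_real (a i) + d i)) powr p)"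
  proof (rule sum_mono)
    fix i assume "i \<in> I"
    show "a i powr p + p * a i powr (p - 1) * Re (d i) \<le>
        (cmod (complex_of_real (a i) + d i)) powr p"
      using powr_tangent_le[OF assms(1)[OF \<open>i \<in> I\<close>] \<open>p > 1\<close>, of "complex_of_real (a i) + d i"]
      by simp
  qed
  finally show ?thesis .
qed

lemma weighted_sum_eq_0_if_const_on_support:
  fixes w :: "nat \<Rightarrow> real" and d :: "nat \<Rightarrow> complex"
  assumes "\<And>i. i \<in> I \<Longrightarrow> d i \<noteq> 0 \<Longrightarrow> w i = c" and "(\<Sum>i\<in>I. d i) = 0"
  shows "(\<Sum>i\<in>I. w i * Re (d i)) = 0"
proof -
  have "(\<Sum>i\<in>I. w i * Re (d i)) = (\<Sum>i\<in>I. c * Re (d i))"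
    using assms(1) by (intro sum.cong) (auto, metis zero_complex.sel(1))
  also have "\<dots> = c * Re (\<Sum>i\<in>I. d i)" by (simp add: sum_distrib_left)
  finally show ?thesis using assms(2) by simp
qed

lemma AE1_le_AE1:
  assumes "p > 0"
    and "(\<Sum>i<N. (cmod (cinner (F i) (G i))) powr p) \<le> (\<Sum>i<N. (cmod (cinner (F i) (G' i))) powr p)"
  shows "AE1 p F G N \<le> AE1 p F G' N"
  unfolding AE1_def using assms
  by (intro powr_mono2 mult_left_mono mult_nonneg_nonneg sum_nonneg) auto

lemma canonical_dual_AE1_le:
  fixes F :: "nat \<Rightarrow> complex ^ 'n"
  assumes frame: "is_frame F N" and "p > 1" and G: "is_dual F G N"
    and partition: "I \<union> J = {..<N}" "I \<inter> J = {}"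
    and disj: "vec.span (F ` I) \<inter> vec.span (F ` J) = {0}"
    and inj: "inj_on F J" and indep: "vec.independent (F ` J)"
    and const: "\<And>i. i \<in> I \<Longrightarrow> cnorm (op_sqrt (inv (frame_op F N)) (F i)) = L"
  shows "AE1 p F (canonical_dual F N) N \<le> AE1 p F G N"
proof -
  define a where "a i = (cnorm (op_sqrt (inv (frame_op F N)) (F i)))\<^sup>2" for i
  define h where "h i = G i - canonical_dual F N i" for i
  have a_nonneg: "a i \<ge> 0" for i unfolding a_def by simp
  have diag: "cinner (F i) (canonical_dual F N i) = complex_of_real (a i)" for i
    unfolding a_def using cinner_canonical_dual[OF frame] .
  have ann: "(\<Sum>i<N. cinner x (F i) *s h i) = 0" for x
    unfolding h_def using dual_diff_annihilated[OF G canonical_dual_is_dual[OF frame]] .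
  have weight_const: "a i powr (p - 1) = (L\<^sup>2) powr (p - 1)"
    if "i \<in> {..<N}" "cinner (F i) (h i) \<noteq> 0" for i
  proof -
    have "h i \<noteq> 0" using that(2) by auto
    then have "i \<notin> J"
      using annihilated_vanishes_on_independent_part[OF ann partition disj inj indep] by metis
    then have "i \<in> I" using that(1) partition(1) by blast
    then show ?thesis unfolding a_def using const by simp
  qed
  have "(\<Sum>i<N. a i powr (p - 1) * Re (cinner (F i) (h i))) = 0"
    using weighted_sum_eq_0_if_const_on_support[OF weight_const annihilated_trace_eq_0[OF ann]] .
  then have "(\<Sum>i<N. a i powr p) \<le>
      (\<Sum>i<N. (cmod (complex_of_real (a i) + cinner (F i) (h i))) powr p)"
    by (rule sum_powr_le_if_tangent_sum_eq_0[OF a_nonneg \<open>p > 1\<close>])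
  moreover have "cinner (F i) (G i) = complex_of_real (a i) + cinner (F i) (h i)" for i
    using cinner_add_right[of "F i" "canonical_dual F N i" "h i"] unfolding h_def diag by simp
  ultimately show ?thesis using \<open>p > 1\<close> a_nonneg by (intro AE1_le_AE1) (simp_all add: diag)
qed

theorem theorem5p5:
  fixes F :: "nat \<Rightarrow> complex ^ 'n" and N :: nat and p L :: real
    and I1 I2 :: "nat set"
  assumes frame: "is_frame F N"
    and p: "p > 1"
    and L_def: "L = Max {cnorm (op_sqrt (inv (frame_op F N)) (F i)) | i. i < N}"
    and I1_def: "I1 = {i. i < N \<and> cnorm (op_sqrt (inv (frame_op F N)) (F i)) = L}"
    and I2_def: "I2 = {..<N} - I1"
    and disj: "vec.span (F ` I1) \<inter> vec.span (F ` I2) = {0}"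
    and indep: "inj_on F I2 \<and> vec.independent (F ` I2)"
  shows "canonical_dual F N \<in> zeta1 p F N"
proof -
  have partition: "I1 \<union> I2 = {..<N}" "I1 \<inter> I2 = {}" unfolding I1_def I2_def by auto
  have I1_const: "cnorm (op_sqrt (inv (frame_op F N)) (F i)) = L" if "i \<in> I1" for i
    using that unfolding I1_def by simp
  have "AE1 p F (canonical_dual F N) N \<le> AE1 p F G N" if "is_dual F G N" for G
    using canonical_dual_AE1_le[OF frame p that partition disj conjunct1[OF indep]
        conjunct2[OF indep] I1_const] .
  then show ?thesis unfolding zeta1_def using canonical_dual_is_dual[OF frame] by blast
qed

end
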